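(* Let $X$ be a $\mathbb{Z}^{d}$-shift of finite type and let $\varphi\in\mathcal{H}(d)$ be an action that factors into $X$. Then there is a neighborhood $U$ of $\varphi$ in $\mathcal{H}(d)$ such that every action $\psi\in U$ factors into $X$.
   Context: $K$ is the Cantor set and $\mathcal{H}=\mathrm{homeo}(K)$ is the Polish group of homeomorphisms of $K$ with the topology of uniform convergence. $\mathcal{H}(d)=\mathrm{Hom}(\mathbb{Z}^{d},\mathcal{H})$ is the space of continuous $\mathbb{Z}^{d}$-actions $\varphi=\{\varphi^{u}\}_{u\in\mathbb{Z}^{d}}$ on $K$, with the topology inherited as a closed subset of the product $\mathcal{H}^{\mathbb{Z}^{d}}$. A shift of finite type (SFT) is a subshift $X\subseteq\Sigma^{\mathbb{Z}^{d}}$ ($\Sigma$ finite) consisting of all configurations in which none of some finite list of finite patterns occurs; it carries the shift action $\sigma=\{\sigma^{u}\}_{u\in\mathbb{Z}^d}$. An action $\varphi\in\mathcal{H}(d)$ factors into $X$ if there is a continuous map $f:K\to X$ (not necessarily onto) with $f\varphi^{u}=\sigma^{u}f$ for all $u\in\mathbb{Z}^{d}$. *)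

theory Defs
  imports "HOL-Analysis.Analysis"
begin

primrec cantor_stage :: "nat \<Rightarrow> real set" where
  "cantor_stage 0 = {0..1}"
| "cantor_stage (Suc n) =
     (\<lambda>x. x / 3) ` cantor_stage n \<union> (\<lambda>x. 2 / 3 + x / 3) ` cantor_stage n"

definition cantor_set :: "real set" where
  "cantor_set = (\<Inter>n. cantor_stage n)"

text \<open>Self-maps of the Cantor set are represented by functions on the reals that take the value
  \<^term>\<open>undefined\<close> off the Cantor set, so that equality of such functions is equality of maps.\<close>

definition homeo :: "(real \<Rightarrow> real) set" where
  "homeo = {f \<in> extensional cantor_set.
     homeomorphic_map (top_of_set cantor_set) (top_of_set cantor_set) f}"

text \<open>The metric of \<^const>\<open>cfunspace\<close> is the supremum metric.\<close>

definition homeo_topology :: "(real \<Rightarrow> real) topology" where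
  "homeo_topology =
     subtopology (mtopology_of (cfunspace (top_of_set cantor_set) euclidean_metric)) homeo"

lemma cantor_set_subset: "cantor_set \<subseteq> {0..1}"
proof -
  have "cantor_set \<subseteq> cantor_stage 0" unfolding cantor_set_def by blast
  then show ?thesis by simp
qed

lemma homeo_image: "f ` cantor_set = cantor_set" if "f \<in> homeo"
  using homeomorphic_imp_surjective_map[of "top_of_set cantor_set" "top_of_set cantor_set" f] that
  by (simp add: homeo_def)

lemma topspace_homeo_topology [simp]: "topspace homeo_topology = homeo"
proof -
  have "f \<in> mspace (cfunspace (top_of_set cantor_set) euclidean_metric)" if f: "f \<in> homeo" for f
  proof -
    have "continuous_map (top_of_set cantor_set) euclidean f"
      using f homeomorphic_imp_continuous_map continuous_map_into_fulltopology
      unfolding homeo_def by blast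
    moreover have "bounded (f ` cantor_set)"
      using homeo_image[OF f] cantor_set_subset bounded_subset bounded_closed_interval by metis
    then have "Metric_space.mbounded UNIV dist (f ` cantor_set)"
      by simp
    ultimately show ?thesis using f by (simp add: homeo_def)
  qed
  then show ?thesis by (auto simp: homeo_topology_def)
qed

text \<open>Group homomorphisms from \<^typ>\<open>int ^ 'd\<close> to \<^const>\<open>homeo\<close>.  As the values are bijections,
  the additivity condition forces \<open>0\<close> to act as the identity.\<close>

definition actions :: "(int ^ 'd \<Rightarrow> real \<Rightarrow> real) set" where
  "actions = {\<phi>. (\<forall>u. \<phi> u \<in> homeo) \<and>
     (\<forall>u v. \<phi> (u + v) = compose cantor_set (\<phi> u) (\<phi> v))}"

definition action_topology :: "(int ^ 'd \<Rightarrow> real \<Rightarrow> real) topology" where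
  "action_topology = subtopology (product_topology (\<lambda>_. homeo_topology) UNIV) actions"

lemma topspace_action_topology [simp]: "topspace action_topology = actions"
  by (auto simp: action_topology_def actions_def)

lemma action_zero: "\<phi> 0 = restrict id cantor_set" if "\<phi> \<in> actions"
proof -
  have h: "\<phi> 0 \<in> homeo" and c: "\<phi> 0 = compose cantor_set (\<phi> 0) (\<phi> 0)"
    using that unfolding actions_def by (blast, metis (mono_tags, lifting) add_0 mem_Collect_eq)
  have "\<phi> 0 x = x" if x: "x \<in> cantor_set" for x
  proof -
    obtain y where y: "y \<in> cantor_set" "x = \<phi> 0 y" using homeo_image[OF h] x by blast
    then show ?thesis using c by (metis compose_eq)
  qed
  moreover have "\<phi> 0 \<in> extensional cantor_set" using h by (simp add: homeo_def)
  ultimately show ?thesis by (auto simp: restrict_def extensional_def)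
qed

definition shift :: "int ^ 'd \<Rightarrow> (int ^ 'd \<Rightarrow> 'a) \<Rightarrow> (int ^ 'd \<Rightarrow> 'a)" where
  "shift u x = (\<lambda>v. x (u + v))"

definition full_shift :: "'a set \<Rightarrow> (int ^ 'd \<Rightarrow> 'a) topology" where
  "full_shift A = product_topology (\<lambda>_. discrete_topology A) UNIV"

text \<open>A finite pattern is a map with finite domain (its shape) from positions to symbols.\<close>

definition finite_pattern :: "'a set \<Rightarrow> (int ^ 'd \<rightharpoonup> 'a) \<Rightarrow> bool" where
  "finite_pattern A p \<longleftrightarrow> finite (dom p) \<and> ran p \<subseteq> A"

definition occurs_in :: "(int ^ 'd \<rightharpoonup> 'a) \<Rightarrow> (int ^ 'd \<Rightarrow> 'a) \<Rightarrow> bool" where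
  "occurs_in p x \<longleftrightarrow> (\<exists>u. \<forall>v \<in> dom p. p v = Some (x (u + v)))"

definition shift_of_finite_type :: "'a set \<Rightarrow> (int ^ 'd \<Rightarrow> 'a) set \<Rightarrow> bool" where
  "shift_of_finite_type A X \<longleftrightarrow> finite A \<and>
     (\<exists>P. finite P \<and> (\<forall>p \<in> P. finite_pattern A p) \<and>
          X = {x \<in> topspace (full_shift A). \<forall>p \<in> P. \<not> occurs_in p x})"

definition factors_into ::
    "(int ^ 'd \<Rightarrow> real \<Rightarrow> real) \<Rightarrow> 'a set \<Rightarrow> (int ^ 'd \<Rightarrow> 'a) set \<Rightarrow> bool" where
  "factors_into \<phi> A X \<longleftrightarrow>
     (\<exists>f. continuous_map (top_of_set cantor_set) (subtopology (full_shift A) X) f \<and>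
          (\<forall>u. \<forall>k \<in> cantor_set. f (\<phi> u k) = shift u (f k)))"

end

theory Submission
  imports Defs
begin

text \<open>A factor map \<open>f\<close> from an action \<open>\<phi>\<close> into a subshift is determined by the symbol it reads at
  the origin: with \<open>g k = f k 0\<close>, equivariance gives \<open>f k u = g (\<phi> u k)\<close>.  Conversely, for any
  action \<open>\<psi>\<close> and any continuous \<open>g\<close> with values in the alphabet, \<open>\<lambda>k u. g (\<psi> u k)\<close> is a
  continuous equivariant map into the full shift.  So the factor map of \<open>\<phi>\<close> has a canonical
  candidate replacement for \<open>\<psi>\<close>: keep \<open>g\<close> and read it along the orbits of \<open>\<psi>\<close>.

  The only question is whether the forbidden patterns stay absent.  By equivariance a pattern has
  to be looked for at the origin only, and there its occurrence depends just on the values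
  \<open>g (\<psi> v k)\<close> for \<open>v\<close> in the shape of the pattern.  Finitely many patterns of finite shape involve
  only a finite window of positions \<open>v\<close>.  As the Cantor set is compact and the alphabet discrete,
  \<open>g\<close> takes equal values at points closer than some \<open>\<delta>\<close>
  (lemma \<open>locally_constant_imp_uniformly\<close>).  If \<open>\<psi> v\<close> is uniformly
  \<open>\<delta>\<close>-close to \<open>\<phi> v\<close> for every \<open>v\<close> in the window, which is an open condition on \<open>\<psi>\<close>
  (lemma \<open>neighbourhood_of_action\<close>), then the orbits of \<open>\<phi>\<close> and
  \<open>\<psi>\<close> show the same symbols in the window, and a forbidden pattern for \<open>\<psi>\<close> would be one for
  \<open>\<phi>\<close>.\<close>

section \<open>Uniformity on the Cantor set\<close>

lemma compact_cantor_stage: "compact (cantor_stage n)"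
proof (induction n)
  case (Suc n)
  then show ?case
    by (auto intro!: compact_Un compact_continuous_image continuous_intros)
qed simp

lemma compact_cantor_set: "compact cantor_set"
proof -
  have "closed cantor_set"
    unfolding cantor_set_def using compact_cantor_stage compact_imp_closed by blast
  moreover have "bounded cantor_set"
    using cantor_set_subset bounded_subset bounded_closed_interval by metis
  ultimately show ?thesis
    by (simp add: compact_eq_bounded_closed)
qed

text \<open>The fibres of a map into a discrete space form an open cover of its domain; any Lebesgue
  number of this cover serves as \<open>\<delta>\<close>.\<close>

lemma locally_constant_imp_uniformly:
  fixes K :: "'b::metric_space set"
  assumes "compact K" and g: "continuous_map (top_of_set K) (discrete_topology A) g"
  obtains \<delta> where "\<delta> > 0"
    and "\<And>x y. \<lbrakk>x \<in> K; y \<in> K; dist x y < \<delta>\<rbrakk> \<Longrightarrow> g x = g y"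
proof -
  have gA: "g x \<in> A" if "x \<in> K" for x
    using continuous_map_image_subset_topspace[OF g] that by auto
  have "\<exists>T. open T \<and> {x \<in> K. g x = a} = K \<inter> T" if "a \<in> A" for a
    using openin_continuous_map_preimage[OF g, of "{a}"] that
    by (simp add: openin_open)
  then obtain T where T: "\<And>a. a \<in> A \<Longrightarrow> open (T a)"
    "\<And>a. a \<in> A \<Longrightarrow> {x \<in> K. g x = a} = K \<inter> T a"
    by metis
  have "K \<subseteq> \<Union> (T ` A)"
    using gA T(2) by blast
  then obtain \<delta> where "\<delta> > 0" and \<delta>: "\<And>x. x \<in> K \<Longrightarrow> \<exists>G \<in> T ` A. ball x \<delta> \<subseteq> G"
    using Heine_Borel_lemma[OF \<open>compact K\<close>, of "T ` A"] T(1) by blast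
  moreover have "g x = g y" if xy: "x \<in> K" "y \<in> K" "dist x y < \<delta>" for x y
  proof -
    obtain a where a: "a \<in> A" "ball x \<delta> \<subseteq> T a"
      using \<delta>[OF xy(1)] by blast
    then have "x \<in> T a" "y \<in> T a"
      using xy \<open>\<delta> > 0\<close> by (auto simp: subset_iff)
    then show ?thesis
      using T(2)[OF a(1)] xy by (metis (mono_tags, lifting) IntI mem_Collect_eq)
  qed
  ultimately show thesis
    using that by blast
qed

section \<open>Neighbourhoods in the space of actions\<close>

lemma neighbourhood_of_homeo:
  assumes h: "h \<in> homeo" and "\<delta> > 0"
  obtains V where "openin homeo_topology V" and "h \<in> V"
    and "\<And>h' k. \<lbrakk>h' \<in> V; k \<in> cantor_set\<rbrakk> \<Longrightarrow> dist (h k) (h' k) < \<delta>"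
proof
  let ?C = "cfunspace (top_of_set cantor_set) (euclidean_metric :: real metric)"
  let ?V = "mball_of ?C h \<delta> \<inter> homeo"
  have "topspace homeo_topology = mspace ?C \<inter> homeo"
    by (simp only: homeo_topology_def topspace_subtopology topspace_mtopology_of)
  then have sub: "homeo \<subseteq> mspace ?C"
    by (simp only: topspace_homeo_topology) blast
  have "openin (mtopology_of ?C) (mball_of ?C h \<delta>)"
    unfolding mtopology_of_def mball_of_def
    by (rule Metric_space.openin_mball[OF Metric_space_mspace_mdist])
  then show "openin homeo_topology ?V"
    unfolding homeo_topology_def openin_subtopology by blast
  have "mdist ?C h h = 0"
    using mdist_zero[of h ?C h] h sub by blast
  with h sub \<open>\<delta> > 0\<close> show "h \<in> ?V"
    unfolding Int_iff in_mball_of by (metis subsetD)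
  show "dist (h k) (h' k) < \<delta>" if "h' \<in> ?V" "k \<in> cantor_set" for h' k
  proof -
    have *: "h \<in> mspace ?C" "h' \<in> mspace ?C" "mdist ?C h h' < \<delta>"
      using that(1) unfolding Int_iff in_mball_of by blast+
    have "compactin (top_of_set cantor_set) (topspace (top_of_set cantor_set))"
      using compact_cantor_set by (simp add: compactin_subtopology)
    from cfunspace_mdist_lt[OF this *] that(2) show ?thesis
      by simp
  qed
qed

text \<open>The topology on actions being a product topology, only finitely many group elements can be
  controlled at once.\<close>

lemma neighbourhood_of_action:
  assumes \<phi>: "\<phi> \<in> actions" and "finite F" and "\<delta> > 0"
  obtains U where "openin action_topology U" and "\<phi> \<in> U"
    and "\<And>\<psi> v k. \<lbrakk>\<psi> \<in> U; v \<in> F; k \<in> cantor_set\<rbrakk> \<Longrightarrow> dist (\<phi> v k) (\<psi> v k) < \<delta>"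
proof -
  have "\<exists>V. openin homeo_topology V \<and> \<phi> v \<in> V \<and>
      (\<forall>h' \<in> V. \<forall>k \<in> cantor_set. dist (\<phi> v k) (h' k) < \<delta>)" for v
  proof -
    have "\<phi> v \<in> homeo"
      using \<phi> by (simp add: actions_def)
    then show ?thesis
      using neighbourhood_of_homeo \<open>\<delta> > 0\<close> by metis
  qed
  then obtain V where V: "\<And>v. openin homeo_topology (V v)" "\<And>v. \<phi> v \<in> V v"
    and close: "\<And>v h' k. \<lbrakk>h' \<in> V v; k \<in> cantor_set\<rbrakk> \<Longrightarrow> dist (\<phi> v k) (h' k) < \<delta>"
    by metis
  define U where "U = {\<psi> \<in> topspace action_topology. \<forall>v \<in> F. \<psi> v \<in> V v}"
  have coord: "openin action_topology {\<psi> \<in> topspace action_topology. \<psi> v \<in> V v}" for v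
  proof -
    have "continuous_map action_topology homeo_topology (\<lambda>\<psi>. \<psi> v)"
      unfolding action_topology_def
      by (intro continuous_map_from_subtopology continuous_map_product_projection UNIV_I)
    then show ?thesis
      using openin_continuous_map_preimage V(1) by fast
  qed
  have "openin action_topology U"
    unfolding U_def using \<open>finite F\<close>
  proof (induction F)
    case (insert w F)
    have "{\<psi> \<in> topspace action_topology. \<forall>v \<in> insert w F. \<psi> v \<in> V v} =
        {\<psi> \<in> topspace action_topology. \<psi> w \<in> V w} \<inter>
        {\<psi> \<in> topspace action_topology. \<forall>v \<in> F. \<psi> v \<in> V v}"
      by blast
    then show ?case
      using insert.IH coord by (simp only: openin_Int)
  qed (simp add: openin_topspace del: topspace_action_topology)
  then show thesis
    using that[of U] \<phi> V(2) close by (simp add: U_def)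
qed

section \<open>Reading a symbol along orbits\<close>

definition itinerary ::
    "('b \<Rightarrow> 'a) \<Rightarrow> (int ^ 'd \<Rightarrow> 'b \<Rightarrow> 'b) \<Rightarrow> 'b \<Rightarrow> (int ^ 'd \<Rightarrow> 'a)" where
  "itinerary g \<psi> k = (\<lambda>u. g (\<psi> u k))"

lemma action_closed: "\<lbrakk>\<psi> \<in> actions; k \<in> cantor_set\<rbrakk> \<Longrightarrow> \<psi> u k \<in> cantor_set"
  unfolding actions_def using homeo_image by blast

lemma action_add:
  "\<lbrakk>\<psi> \<in> actions; k \<in> cantor_set\<rbrakk> \<Longrightarrow> \<psi> (u + v) k = \<psi> u (\<psi> v k)"
  unfolding actions_def by (auto simp: compose_eq)

lemma continuous_map_action:
  assumes "\<psi> \<in> actions"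
  shows "continuous_map (top_of_set cantor_set) (top_of_set cantor_set) (\<psi> u)"
proof -
  have "\<psi> u \<in> homeo"
    using assms by (simp add: actions_def)
  then show ?thesis
    unfolding homeo_def using homeomorphic_imp_continuous_map by blast
qed

lemma itinerary_equivariant:
  assumes "\<psi> \<in> actions" "k \<in> cantor_set"
  shows "itinerary g \<psi> (\<psi> u k) = shift u (itinerary g \<psi> k)"
proof
  fix v
  have "\<psi> v (\<psi> u k) = \<psi> (u + v) k"
    using action_add[OF assms, of v u] by (simp add: add.commute)
  then show "itinerary g \<psi> (\<psi> u k) v = shift u (itinerary g \<psi> k) v"
    by (simp add: itinerary_def shift_def)
qed

lemma continuous_map_itinerary:
  assumes "\<psi> \<in> actions"
    and "continuous_map (top_of_set cantor_set) (discrete_topology A) g"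
  shows "continuous_map (top_of_set cantor_set) (full_shift A) (itinerary g \<psi>)"
proof -
  have "continuous_map (top_of_set cantor_set) (discrete_topology A) (g \<circ> \<psi> u)" for u
    using continuous_map_compose[OF continuous_map_action] assms by blast
  then show ?thesis
    by (simp add: full_shift_def continuous_map_componentwise_UNIV itinerary_def o_def)
qed

text \<open>Equivariance moves an occurrence anywhere in the itinerary of \<open>k\<close> to an occurrence at the
  origin in the itinerary of another point.\<close>

lemma occurs_in_itinerary:
  assumes "\<psi> \<in> actions" "k \<in> cantor_set" "occurs_in p (itinerary g \<psi> k)"
  obtains k' where "k' \<in> cantor_set" and "\<forall>v \<in> dom p. p v = Some (g (\<psi> v k'))"
proof -
  obtain u where u: "\<forall>v \<in> dom p. p v = Some (itinerary g \<psi> k (u + v))"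
    using assms(3) unfolding occurs_in_def by blast
  have "itinerary g \<psi> k (u + v) = g (\<psi> v (\<psi> u k))" for v
    using itinerary_equivariant[OF assms(1,2), of g u]
    by (simp add: itinerary_def shift_def fun_eq_iff)
  with u show thesis
    using that[of "\<psi> u k"] action_closed[OF assms(1,2)] by simp
qed

lemma factor_map_eq_itinerary:
  assumes \<phi>: "\<phi> \<in> actions" and "factors_into \<phi> A X"
  obtains g where "continuous_map (top_of_set cantor_set) (discrete_topology A) g"
    and "\<And>k. k \<in> cantor_set \<Longrightarrow> itinerary g \<phi> k \<in> X"
proof -
  obtain f where f: "continuous_map (top_of_set cantor_set) (subtopology (full_shift A) X) f"
    and eqv: "\<And>u k. k \<in> cantor_set \<Longrightarrow> f (\<phi> u k) = shift u (f k)"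
    using assms(2) unfolding factors_into_def by blast
  have "continuous_map (top_of_set cantor_set) (full_shift A) f" and fX: "f ` cantor_set \<subseteq> X"
    using f by (auto simp: continuous_map_in_subtopology)
  then have "continuous_map (top_of_set cantor_set) (discrete_topology A) (\<lambda>k. f k 0)"
    by (simp add: full_shift_def continuous_map_componentwise_UNIV)
  moreover have "itinerary (\<lambda>k. f k 0) \<phi> k \<in> X" if "k \<in> cantor_set" for k
  proof -
    have "itinerary (\<lambda>k. f k 0) \<phi> k = f k"
      using eqv[OF that] by (simp add: itinerary_def shift_def)
    then show ?thesis
      using fX that by auto
  qed
  ultimately show thesis
    using that by blast
qed

section \<open>Openness of factoring into a shift of finite type\<close>

theorem theorem1:
  fixes A :: "'a set" and X :: "(int ^ 'd \<Rightarrow> 'a) set"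
    and \<phi> :: "int ^ 'd \<Rightarrow> real \<Rightarrow> real"
  assumes "shift_of_finite_type A X"
    and "\<phi> \<in> actions"
    and "factors_into \<phi> A X"
  shows "\<exists>U. openin action_topology U \<and> \<phi> \<in> U \<and> (\<forall>\<psi> \<in> U. factors_into \<psi> A X)"
proof -
  obtain P where P: "finite P" "\<And>p. p \<in> P \<Longrightarrow> finite_pattern A p"
    and X: "X = {x \<in> topspace (full_shift A). \<forall>p \<in> P. \<not> occurs_in p x}"
    using assms(1) unfolding shift_of_finite_type_def by blast
  obtain g where g: "continuous_map (top_of_set cantor_set) (discrete_topology A) g"
    and gX: "\<And>k. k \<in> cantor_set \<Longrightarrow> itinerary g \<phi> k \<in> X"
    using factor_map_eq_itinerary[OF assms(2,3)] by blast
  obtain \<delta> where "\<delta> > 0"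
    and \<delta>: "\<And>x y. \<lbrakk>x \<in> cantor_set; y \<in> cantor_set; dist x y < \<delta>\<rbrakk> \<Longrightarrow> g x = g y"
    using locally_constant_imp_uniformly[OF compact_cantor_set g] by blast
  define F where "F = (\<Union>p\<in>P. dom p)"
  have "finite F"
    using P by (auto simp: F_def finite_pattern_def)
  then obtain U where U: "openin action_topology U" "\<phi> \<in> U"
    and close: "\<And>\<psi> v k. \<lbrakk>\<psi> \<in> U; v \<in> F; k \<in> cantor_set\<rbrakk> \<Longrightarrow> dist (\<phi> v k) (\<psi> v k) < \<delta>"
    using neighbourhood_of_action[OF assms(2) _ \<open>\<delta> > 0\<close>] by blast
  have "factors_into \<psi> A X" if "\<psi> \<in> U" for \<psi>
  proof -
    have \<psi>: "\<psi> \<in> actions"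
      using openin_subset[OF U(1)] that by auto
    have same: "g (\<psi> v k) = g (\<phi> v k)" if "v \<in> F" "k \<in> cantor_set" for v k
      using \<delta>[OF _ _ close[OF \<open>\<psi> \<in> U\<close> that]] action_closed[OF \<psi> that(2)]
        action_closed[OF assms(2) that(2)] by simp
    have cont: "continuous_map (top_of_set cantor_set) (full_shift A) (itinerary g \<psi>)"
      using continuous_map_itinerary[OF \<psi> g] .
    have "itinerary g \<psi> k \<in> X" if "k \<in> cantor_set" for k
    proof -
      have "\<not> occurs_in p (itinerary g \<psi> k)" if "p \<in> P" for p
      proof
        assume "occurs_in p (itinerary g \<psi> k)"
        then obtain k' where k': "k' \<in> cantor_set"
          and "\<forall>v \<in> dom p. p v = Some (g (\<psi> v k'))"
          using occurs_in_itinerary[OF \<psi> \<open>k \<in> cantor_set\<close>] by blast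
        then have "\<forall>v \<in> dom p. p v = Some (itinerary g \<phi> k' (0 + v))"
          using same[OF _ k'] \<open>p \<in> P\<close> by (auto simp: F_def itinerary_def)
        then have "occurs_in p (itinerary g \<phi> k')"
          unfolding occurs_in_def by blast
        then show False
          using gX[OF k'] \<open>p \<in> P\<close> X by blast
      qed
      moreover have "itinerary g \<psi> k \<in> topspace (full_shift A)"
        using continuous_map_image_subset_topspace[OF cont] that by auto
      ultimately show ?thesis
        using X by blast
    qed
    then have "continuous_map (top_of_set cantor_set) (subtopology (full_shift A) X) (itinerary g \<psi>)"
      using cont by (auto simp: continuous_map_in_subtopology)
    then show ?thesis
      unfolding factors_into_def using itinerary_equivariant[OF \<psi>] by blast
  qed
  with U show ?thesis
    by blast
qed

end
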